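(* Let $D$ be the set of transpositions of $\mathrm{Sym}(m)$, let $\hat A=\hat A^\alpha_3(\mathrm A_{m-1})$ and let $A=A^\alpha_3(\mathrm A_{m-1})\subseteq \hat A$, and assume $1+\alpha(m-2)\ne 0$. Suppose $a,b,c,d\in D$ are such that $\langle a,b\rangle\cong {C_2}^2$ and $\langle c,d\rangle\cong{C_2}^2$ have equal support in $\{1,\dots,m\}$, and $\{a,b\}\ne\{c,d\}$. Then $$\alpha\,(a^\rho_++b^\rho_+-c^\rho_+-d^\rho_+)+(1-\alpha)\,(a^\rho_-+b^\rho_--c^\rho_--d^\rho_-)$$ is an eigenvector of (multiplication by) $\mathrm{id}_A$ in $\hat A$, with eigenvalue $$\hat\eta(m)=\frac{\alpha(m-1)}{1+\alpha(m-2)}.$$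
   Context: Let $\mathbb F$ be a field of characteristic $0$ and $\alpha\in\mathbb F\setminus\{0,1\}$. Write $x^y=y^{-1}xy$. The algebra $\hat A=\hat A^\alpha_3(\mathrm A_{m-1})$ is the commutative, not necessarily associative, $\mathbb F$-algebra with basis $\{x^\rho_+,x^\rho_-\mid x\in D\}$ and multiplication, for $x,y\in D$ and $\varepsilon,\varepsilon'\in\{+,-\}$, $$x^\rho_\varepsilon y^\rho_{\varepsilon'}=\begin{cases} x^\rho_\varepsilon & x=y,\ \varepsilon=\varepsilon',\\ \frac{\alpha}{2}\bigl(x^\rho_\varepsilon+y^\rho_{\varepsilon'}-(x^y)^\rho_{\varepsilon\varepsilon'}\bigr) & [x,y]\ne1,\\ 0&\text{otherwise,}\end{cases}$$ where $\varepsilon\varepsilon'$ is the product of signs. The algebra $A=A^\alpha_3(\mathrm A_{m-1})$ is the subalgebra of $\hat A$ spanned by $\{x^\rho_+\mid x\in D\}$; its identity element is $\mathrm{id}_A=\frac{1}{1+\alpha(m-2)}\sum_{x\in D}x^\rho_+$. *)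

theory Defs
  imports
    Complex_Main
    "HOL-Algebra.Sym_Groups"
    "HOL-Algebra.Elementary_Groups"
    "HOL-Library.Function_Algebras"
begin

definition transpositions :: "nat \<Rightarrow> (nat \<Rightarrow> nat) set" where
  "transpositions m = {transpose i j | i j. i \<in> {1..m} \<and> j \<in> {1..m} \<and> i \<noteq> j}"

definition conjugate :: "('g, 'h) monoid_scheme \<Rightarrow> 'g \<Rightarrow> 'g \<Rightarrow> 'g" where
  "conjugate G x y = inv\<^bsub>G\<^esub> y \<otimes>\<^bsub>G\<^esub> x \<otimes>\<^bsub>G\<^esub> y"

definition commutator :: "('g, 'h) monoid_scheme \<Rightarrow> 'g \<Rightarrow> 'g \<Rightarrow> 'g" where
  "commutator G x y = inv\<^bsub>G\<^esub> x \<otimes>\<^bsub>G\<^esub> inv\<^bsub>G\<^esub> y \<otimes>\<^bsub>G\<^esub> x \<otimes>\<^bsub>G\<^esub> y"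

definition perm_support :: "nat \<Rightarrow> (nat \<Rightarrow> nat) set \<Rightarrow> nat set" where
  "perm_support m H = {i \<in> {1..m}. \<exists>h\<in>H. h i \<noteq> i}"

abbreviation klein_four :: "(int \<times> int) monoid" where
  "klein_four \<equiv> integer_mod_group 2 \<times>\<times> integer_mod_group 2"

datatype pm = PlusS | MinusS

definition pm_mult :: "pm \<Rightarrow> pm \<Rightarrow> pm" where
  "pm_mult e e' = (if e = e' then PlusS else MinusS)"

text \<open>
  Vectors are coefficient functions on pairs of a permutation and a sign, with the pointwise
  addition of \<^theory>\<open>HOL-Library.Function_Algebras\<close>; the pointwise product from that
  theory is not the product of the algebra.
\<close>

type_synonym 'k vec = "(nat \<Rightarrow> nat) \<times> pm \<Rightarrow> 'k"

definition scale :: "'k::field \<Rightarrow> 'k vec \<Rightarrow> 'k vec" where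
  "scale c v = (\<lambda>p. c * v p)"

interpretation vec: vector_space "scale :: 'k::field \<Rightarrow> 'k vec \<Rightarrow> 'k vec"
  by unfold_locales (auto simp: scale_def fun_eq_iff algebra_simps)

definition rho :: "(nat \<Rightarrow> nat) \<Rightarrow> pm \<Rightarrow> 'k::field vec" where
  "rho x e = (\<lambda>p. if p = (x, e) then 1 else 0)"

definition A_hat :: "nat \<Rightarrow> 'k::field vec set" where
  "A_hat m = vec.span {rho x e | x e. x \<in> transpositions m}"

definition A_sub :: "nat \<Rightarrow> 'k::field vec set" where
  "A_sub m = vec.span {rho x PlusS | x. x \<in> transpositions m}"

definition basis_mult ::
  "'k::field \<Rightarrow> nat \<Rightarrow> (nat \<Rightarrow> nat) \<times> pm \<Rightarrow> (nat \<Rightarrow> nat) \<times> pm \<Rightarrow> 'k vec" where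
  "basis_mult \<alpha> m = (\<lambda>(x, e) (y, e').
     if x = y \<and> e = e' then rho x e
     else if commutator (sym_group m) x y \<noteq> \<one>\<^bsub>sym_group m\<^esub>
       then scale (\<alpha> / 2) (rho x e + rho y e' - rho (conjugate (sym_group m) x y) (pm_mult e e'))
     else 0)"

text \<open>The bilinear extension of the product of basis vectors.\<close>

definition alg_mult :: "'k::field \<Rightarrow> nat \<Rightarrow> 'k vec \<Rightarrow> 'k vec \<Rightarrow> 'k vec" where
  "alg_mult \<alpha> m v w =
     (\<Sum>p \<in> transpositions m \<times> UNIV. \<Sum>q \<in> transpositions m \<times> UNIV.
        scale (v p * w q) (basis_mult \<alpha> m p q))"

lemma finite_transpositions: "finite (transpositions m)"
proof -
  have "transpositions m \<subseteq> (\<lambda>(i, j). transpose i j) ` ({1..m} \<times> {1..m})"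
    by (auto simp: transpositions_def)
  then show ?thesis
    by (rule finite_subset) simp
qed

lemma alg_mult_rho:
  assumes "x \<in> transpositions m" "y \<in> transpositions m"
  shows "alg_mult \<alpha> m (rho x e) (rho y e') = basis_mult \<alpha> m (x, e) (y, e')"
proof -
  have fin: "finite (transpositions m \<times> (UNIV :: pm set))"
  proof -
    have "(UNIV :: pm set) = {PlusS, MinusS}"
      using pm.exhaust by auto
    then have "finite (UNIV :: pm set)"
      by (metis finite.emptyI finite.insertI)
    then show ?thesis
      by (simp add: finite_transpositions)
  qed
  have "alg_mult \<alpha> m (rho x e) (rho y e') =
    (\<Sum>p \<in> transpositions m \<times> UNIV. if p = (x, e) then
      (\<Sum>q \<in> transpositions m \<times> UNIV. if q = (y, e') then basis_mult \<alpha> m p q else 0) else 0)"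
    unfolding alg_mult_def rho_def
    by (intro sum.cong refl) (auto intro!: sum.cong sum.neutral)
  also have "\<dots> = basis_mult \<alpha> m (x, e) (y, e')"
    using assms fin by (simp add: sum.delta)
  finally show ?thesis .
qed

definition is_identity :: "'k::field \<Rightarrow> nat \<Rightarrow> 'k vec set \<Rightarrow> 'k vec \<Rightarrow> bool" where
  "is_identity \<alpha> m B u \<longleftrightarrow>
     u \<in> B \<and> (\<forall>v\<in>B. alg_mult \<alpha> m u v = v \<and> alg_mult \<alpha> m v u = v)"

text \<open>
  When \<open>1 + \<alpha> (m - 2) \<noteq> 0\<close>, the identity element exists and is
  \<open>(1 / (1 + \<alpha> (m - 2))) \<Sum>x. rho x PlusS\<close>, summed over all transpositions;
  otherwise \<open>id_A\<close> may be an unspecified vector.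
\<close>

definition id_A :: "'k::field \<Rightarrow> nat \<Rightarrow> 'k vec" where
  "id_A \<alpha> m = (THE u. is_identity \<alpha> m (A_sub m) u)"

definition is_eigenvector :: "'k::field \<Rightarrow> nat \<Rightarrow> 'k vec \<Rightarrow> 'k \<Rightarrow> 'k vec \<Rightarrow> bool" where
  "is_eigenvector \<alpha> m u \<eta> v \<longleftrightarrow>
     v \<in> A_hat m \<and> v \<noteq> 0 \<and> alg_mult \<alpha> m u v = scale \<eta> v"

definition eta_hat :: "'k::field \<Rightarrow> nat \<Rightarrow> 'k" where
  "eta_hat \<alpha> m = \<alpha> * (of_nat m - 1) / (1 + \<alpha> * (of_nat m - 2))"

end

theory Submission
  imports Defs
begin

text \<open>
  Let \<open>S\<close> be the sum of all \<open>x\<^sub>+\<close>, so that \<open>id\<^sub>A = S / (1 + \<alpha> (m - 2))\<close>. Then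
  \<open>S x\<^sub>+ = (1 + \<alpha> (m - 2)) x\<^sub>+\<close> and \<open>S x\<^sub>- = \<alpha> (m - 2) x\<^sub>- + (\<alpha> / 2) N\<^sub>x\<close>, where \<open>N\<^sub>x\<close> is the
  sum of \<open>y\<^sub>+ - y\<^sub>-\<close> over the \<open>y\<close> not commuting with \<open>x\<close>. For \<open>x = (i j)\<close> this sum is
  \<open>R\<^sub>i + R\<^sub>j - 2 (x\<^sub>+ - x\<^sub>-)\<close>, where \<open>R\<^sub>i\<close> runs over all \<open>y\<close> moving \<open>i\<close>. Hence
  \<open>N\<^sub>a + N\<^sub>b + 2 (a\<^sub>+ - a\<^sub>- + b\<^sub>+ - b\<^sub>-)\<close> depends only on the common support of \<open>a\<close> and \<open>b\<close>, and
  \<open>S\<close> preserves the span of \<open>a\<^sub>\<epsilon> + b\<^sub>\<epsilon> - c\<^sub>\<epsilon> - d\<^sub>\<epsilon>\<close> (\<open>\<epsilon> = \<plusminus>\<close>), where it acts triangularly.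
\<close>

section \<open>Transpositions as involutions and the product of basis vectors\<close>

lemma transpositionsE:
  assumes "x \<in> transpositions m"
  obtains i j where "x = transpose i j" "i \<in> {1..m}" "j \<in> {1..m}" "i \<noteq> j"
  using assms by (auto simp: transpositions_def)

lemma transpose_in_transpositions:
  "i \<in> {1..m} \<Longrightarrow> j \<in> {1..m} \<Longrightarrow> i \<noteq> j \<Longrightarrow> transpose i j \<in> transpositions m"
  by (auto simp: transpositions_def)

lemma transpositions_square: "x \<in> transpositions m \<Longrightarrow> x \<circ> x = id"
  by (auto simp: transpositions_def)

lemma transpositions_permutes: "x \<in> transpositions m \<Longrightarrow> x permutes {1..m}"
  by (auto simp: transpositions_def intro: permutes_swap_id)

lemma inv_sym_group_transpositions:
  assumes "x \<in> transpositions m"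
  shows "inv\<^bsub>sym_group m\<^esub> x = x"
  using assms
  by (intro group.inv_equality[OF sym_group_is_group])
     (auto simp: sym_group_mult sym_group_one sym_group_carrier transpositions_square
        transpositions_permutes simp del: One_nat_def)

lemma conjugate_transpositions:
  "x \<in> transpositions m \<Longrightarrow> y \<in> transpositions m \<Longrightarrow> conjugate (sym_group m) x y = y \<circ> x \<circ> y"
  by (simp add: conjugate_def inv_sym_group_transpositions sym_group_mult)

text \<open>Both elements are involutions, so the commutator is the word \<open>x y x y\<close>, and
  cancelling on the right turns its triviality into commutation.\<close>

lemma commutator_transpositions_eq_one_iff:
  assumes "x \<in> transpositions m" "y \<in> transpositions m"
  shows "commutator (sym_group m) x y = \<one>\<^bsub>sym_group m\<^esub> \<longleftrightarrow> x \<circ> y = y \<circ> x"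
proof -
  have sq: "x (x t) = t" "y (y t) = t" for t
    using assms[THEN transpositions_square] by (auto simp: fun_eq_iff)
  have "x \<circ> y \<circ> x \<circ> y = id \<longleftrightarrow> x \<circ> y = y \<circ> x"
    unfolding fun_eq_iff comp_apply id_apply by (metis sq)
  then show ?thesis
    using assms
    by (simp add: commutator_def inv_sym_group_transpositions sym_group_mult sym_group_one)
qed

lemma basis_mult_transpositions:
  assumes "x \<in> transpositions m" "y \<in> transpositions m"
  shows "basis_mult \<alpha> m (x, e) (y, e') =
    (if x = y \<and> e = e' then rho x e
     else if x \<circ> y \<noteq> y \<circ> x
       then scale (\<alpha> / 2) (rho x e + rho y e' - rho (y \<circ> x \<circ> y) (pm_mult e e'))
     else 0)"
  using assms
  by (simp add: basis_mult_def commutator_transpositions_eq_one_iff conjugate_transpositions)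

lemma transpose_conj_adjacent:
  assumes "i \<noteq> j" "i \<noteq> k" "j \<noteq> k"
  shows "transpose i j \<circ> transpose i k \<circ> transpose i j = transpose j k"
    and "transpose i j \<circ> transpose j k \<circ> transpose i j = transpose i k"
  using assms by (auto simp: fun_eq_iff transpose_def)

lemma transpose_adjacent_not_commute:
  assumes "i \<noteq> j" "i \<noteq> k" "j \<noteq> k"
  shows "transpose i k \<circ> transpose i j \<noteq> transpose i j \<circ> transpose i k"
proof
  assume "transpose i k \<circ> transpose i j = transpose i j \<circ> transpose i k"
  then have "(transpose i k \<circ> transpose i j) i = (transpose i j \<circ> transpose i k) i"
    by simp
  then show False
    using assms by simp
qed

section \<open>Transpositions that do not commute with a given one\<close>

definition noncommuting :: "nat \<Rightarrow> (nat \<Rightarrow> nat) \<Rightarrow> (nat \<Rightarrow> nat) set" where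
  "noncommuting m y = {x \<in> transpositions m. x \<circ> y \<noteq> y \<circ> x}"

text \<open>Two transpositions fail to commute exactly when they share exactly one point. Writing
  the set as two images indexed by the third point prepares the pairing of (i k) with (j k).\<close>

lemma noncommuting_transpose:
  assumes "i \<in> {1..m}" "j \<in> {1..m}" "i \<noteq> j"
  shows "noncommuting m (transpose i j) =
    transpose i ` ({1..m} - {i, j}) \<union> transpose j ` ({1..m} - {i, j})"
proof (intro equalityI subsetI)
  fix x assume "x \<in> noncommuting m (transpose i j)"
  then have nc: "x \<circ> transpose i j \<noteq> transpose i j \<circ> x" and "x \<in> transpositions m"
    by (auto simp: noncommuting_def)
  then obtain k l where x: "x = transpose k l" "k \<in> {1..m}" "l \<in> {1..m}" "k \<noteq> l"
    by (auto elim: transpositionsE)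
  have "\<not> (k \<notin> {i, j} \<and> l \<notin> {i, j})"
  proof
    assume "k \<notin> {i, j} \<and> l \<notin> {i, j}"
    then have "x \<circ> transpose i j = transpose i j \<circ> x"
      using x by (auto simp: fun_eq_iff transpose_def)
    with nc show False ..
  qed
  moreover have "{k, l} \<noteq> {i, j}"
    using nc x by (auto simp: doubleton_eq_iff transpose_commute)
  ultimately consider "k \<in> {i, j}" "l \<notin> {i, j}" | "l \<in> {i, j}" "k \<notin> {i, j}"
    using x by blast
  then show "x \<in> transpose i ` ({1..m} - {i, j}) \<union> transpose j ` ({1..m} - {i, j})"
    using x by cases (auto simp: transpose_commute)
next
  fix x assume "x \<in> transpose i ` ({1..m} - {i, j}) \<union> transpose j ` ({1..m} - {i, j})"
  then show "x \<in> noncommuting m (transpose i j)"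
    using assms transpose_adjacent_not_commute[of i j] transpose_adjacent_not_commute[of j i]
    by (auto simp: noncommuting_def transpose_commute[of j i] intro!: transpose_in_transpositions)
qed

lemma inj_on_transpose_right: "inj_on (transpose i) (- {i})"
  by (rule inj_onI) (metis transpose_apply_first)

lemma sum_noncommuting:
  fixes f :: "(nat \<Rightarrow> nat) \<Rightarrow> 'a::comm_monoid_add"
  assumes "i \<in> {1..m}" "j \<in> {1..m}" "i \<noteq> j"
  shows "sum f (noncommuting m (transpose i j)) =
    (\<Sum>k\<in>{1..m} - {i, j}. f (transpose i k) + f (transpose j k))"
proof -
  let ?K = "{1..m} - {i, j}"
  have inj: "inj_on (transpose i) ?K" "inj_on (transpose j) ?K"
    by (rule inj_on_subset[OF inj_on_transpose_right], blast)+
  \<comment> \<open>Every element of the first image moves i, while every element of the second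
    fixes it.\<close>
  have disj: "transpose i ` ?K \<inter> transpose j ` ?K = {}"
  proof -
    have "transpose i k \<noteq> transpose j l" if "k \<in> ?K" "l \<in> ?K" for k l
      using that assms by (metis DiffD2 insertCI transpose_apply_first transpose_apply_other)
    then show ?thesis
      by blast
  qed
  show ?thesis
    by (simp add: noncommuting_transpose[OF assms] sum.union_disjoint disj sum.reindex inj
        sum.distrib del: One_nat_def)
qed

text \<open>The two transpositions lie on three common points, and both sides are the third
  transposition there. This makes the asymmetric-looking term
  \<open>conjugate (sym_group m) x y\<close> symmetric in x and y.\<close>

lemma braid_transpositions:
  assumes "x \<in> transpositions m" "y \<in> transpositions m" "x \<circ> y \<noteq> y \<circ> x"
  shows "y \<circ> x \<circ> y = x \<circ> y \<circ> x"
proof -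
  from assms(2) obtain i j where y: "y = transpose i j" "i \<in> {1..m}" "j \<in> {1..m}" "i \<noteq> j"
    by (rule transpositionsE)
  have "x \<in> noncommuting m (transpose i j)"
    using assms y by (auto simp: noncommuting_def)
  then obtain k where "k \<noteq> i" "k \<noteq> j" "x = transpose i k \<or> x = transpose j k"
    unfolding noncommuting_transpose[OF y(2-4)] by auto
  then show ?thesis
    using y(4) transpose_conj_adjacent(1)[of i j k] transpose_conj_adjacent(1)[of i k j]
      transpose_conj_adjacent(1)[of j i k] transpose_conj_adjacent(1)[of j k i]
    unfolding y(1) by (metis transpose_commute)
qed

section \<open>Commutativity and bilinearity of the product\<close>

lemma finite_UNIV_pm: "finite (UNIV :: pm set)"
proof (rule finite_subset)
  show "(UNIV :: pm set) \<subseteq> {PlusS, MinusS}"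
    using pm.exhaust by blast
qed simp

lemma pm_mult_commute: "pm_mult e e' = pm_mult e' e"
  by (auto simp: pm_mult_def)

lemma basis_mult_commute:
  assumes "x \<in> transpositions m" "y \<in> transpositions m"
  shows "basis_mult \<alpha> m (x, e) (y, e') = basis_mult \<alpha> m (y, e') (x, e)"
proof (cases "x \<circ> y = y \<circ> x")
  case True
  then show ?thesis
    using assms by (auto simp: basis_mult_transpositions)
next
  case False
  with assms have "y \<circ> x \<circ> y = x \<circ> y \<circ> x"
    by (rule braid_transpositions)
  with False assms show ?thesis
    by (auto simp: basis_mult_transpositions pm_mult_commute add.commute)
qed

text \<open>No membership in \<open>A_hat m\<close> is required: \<open>alg_mult\<close> reads only
  the coefficients at transpositions, where the basis products commute. Linearity then has to be
  shown in one argument only.\<close>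

lemma alg_mult_commute: "alg_mult \<alpha> m v w = alg_mult \<alpha> m w v"
proof -
  let ?B = "transpositions m \<times> (UNIV :: pm set)"
  have "alg_mult \<alpha> m v w = (\<Sum>q\<in>?B. \<Sum>p\<in>?B. scale (v p * w q) (basis_mult \<alpha> m p q))"
    unfolding alg_mult_def by (rule sum.swap)
  also have "\<dots> = (\<Sum>q\<in>?B. \<Sum>p\<in>?B. scale (w q * v p) (basis_mult \<alpha> m q p))"
  proof (intro sum.cong refl)
    fix p q assume "q \<in> ?B" "p \<in> ?B"
    then have "basis_mult \<alpha> m p q = basis_mult \<alpha> m q p"
      by (cases p, cases q) (auto intro: basis_mult_commute)
    then show "scale (v p * w q) (basis_mult \<alpha> m p q) = scale (w q * v p) (basis_mult \<alpha> m q p)"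
      by (simp add: mult.commute)
  qed
  finally show ?thesis
    by (simp add: alg_mult_def)
qed

lemma module_hom_alg_mult: "module_hom scale scale (alg_mult \<alpha> m u)"
proof unfold_locales
  show "alg_mult \<alpha> m u (v + w) = alg_mult \<alpha> m u v + alg_mult \<alpha> m u w" for v w
    by (simp add: alg_mult_def distrib_left vec.scale_left_distrib sum.distrib)
  show "alg_mult \<alpha> m u (scale r v) = scale r (alg_mult \<alpha> m u v)" for r v
    by (simp add: alg_mult_def vec.scale_sum_right scale_def[of r v] mult.left_commute)
qed

lemmas alg_mult_add_right = module_hom.add[OF module_hom_alg_mult]
  and alg_mult_diff_right = module_hom.diff[OF module_hom_alg_mult]
  and alg_mult_scale_right = module_hom.scale[OF module_hom_alg_mult]
  and alg_mult_sum_right = module_hom.sum[OF module_hom_alg_mult]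

lemma alg_mult_scale_left: "alg_mult \<alpha> m (scale r u) v = scale r (alg_mult \<alpha> m u v)"
  by (simp only: alg_mult_commute[of \<alpha> m _ v] alg_mult_scale_right)

section \<open>Multiplication by the sum of all plus vectors, and the identity element\<close>

definition plus_sum :: "nat \<Rightarrow> 'k::field vec" where
  "plus_sum m = (\<Sum>x\<in>transpositions m. rho x PlusS)"

definition rho_diff :: "(nat \<Rightarrow> nat) \<Rightarrow> 'k::field vec" where
  "rho_diff x = rho x PlusS - rho x MinusS"

text \<open>Conjugation by the transposition permutes the noncommuting ones by swapping
  \<open>(i k)\<close> and \<open>(j k)\<close>, so the conjugated terms can be put back on \<open>(i k)\<close> and \<open>(j k)\<close>.\<close>

lemma alg_mult_plus_sum:
  fixes \<alpha> :: "'k::field_char_0"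
  assumes "i \<in> {1..m}" "j \<in> {1..m}" "i \<noteq> j"
  shows "alg_mult \<alpha> m (plus_sum m) (rho (transpose i j) e) =
    (if e = PlusS then rho (transpose i j) e else 0)
    + scale (\<alpha> * (of_nat m - 2)) (rho (transpose i j) e)
    + scale (\<alpha> / 2) (\<Sum>x\<in>noncommuting m (transpose i j). rho x PlusS - rho x e)"
proof -
  let ?y = "transpose i j" and ?T = "transpositions m" and ?K = "{1..m} - {i, j}"
  let ?c = "\<lambda>x. scale (\<alpha> / 2) (rho x PlusS + rho ?y e - rho (?y \<circ> x \<circ> ?y) e)"
  have y: "?y \<in> ?T"
    using assms by (rule transpose_in_transpositions)
  have pm: "pm_mult PlusS e = e"
    by (cases e) (auto simp: pm_mult_def)
  have "alg_mult \<alpha> m (plus_sum m) (rho ?y e) =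
      (\<Sum>x\<in>?T. alg_mult \<alpha> m (rho x PlusS) (rho ?y e))"
    unfolding plus_sum_def by (subst (1 2) alg_mult_commute) (rule alg_mult_sum_right)
  \<comment> \<open>The diagonal term x = \<open>?y\<close> survives only for equal signs; for
    opposite signs the product is 0, because \<open>?y\<close> commutes with itself.\<close>
  also have "\<dots> = (\<Sum>x\<in>?T. (if x = ?y then if e = PlusS then rho ?y e else 0 else 0)
      + (if x \<circ> ?y \<noteq> ?y \<circ> x then ?c x else 0))"
    using y by (intro sum.cong refl) (auto simp: alg_mult_rho basis_mult_transpositions pm)
  also have "\<dots> = (if e = PlusS then rho ?y e else 0) + (\<Sum>x\<in>noncommuting m ?y. ?c x)"
    using y unfolding noncommuting_def
    by (simp only: sum.distrib sum.delta finite_transpositions sum.inter_filter if_True)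
  also have "(\<Sum>x\<in>noncommuting m ?y. ?c x) =
      (\<Sum>k\<in>?K. ?c (transpose i k) + ?c (transpose j k))"
    by (rule sum_noncommuting[OF assms])
  \<comment> \<open>Each of the two members of a pair contributes half of \<alpha> times
    \<open>rho ?y e\<close>.\<close>
  also have "\<dots> = (\<Sum>k\<in>?K. scale \<alpha> (rho ?y e)
      + scale (\<alpha> / 2) ((rho (transpose i k) PlusS - rho (transpose i k) e)
                    + (rho (transpose j k) PlusS - rho (transpose j k) e)))"
    using assms
    by (intro sum.cong refl) (auto simp: transpose_conj_adjacent scale_def fun_eq_iff field_simps)
  also have "\<dots> = scale (of_nat (card ?K) * \<alpha>) (rho ?y e)
      + scale (\<alpha> / 2) (\<Sum>x\<in>noncommuting m ?y. rho x PlusS - rho x e)"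
    by (simp add: sum.distrib vec.scale_sum_right[symmetric] sum_noncommuting[OF assms]
        vec.sum_constant_scale del: sum_constant)
  \<comment> \<open>Two distinct points in \<open>{1..m}\<close> force 2 \<le> m, so the
    natural-number difference m - 2 is not truncated.\<close>
  also have "(of_nat (card ?K) :: 'k) = of_nat m - 2"
  proof -
    have "card ?K = m - 2"
      using assms by (subst card_Diff_subset) auto
    moreover have "2 \<le> m"
      using assms by auto
    ultimately show ?thesis
      by (simp add: of_nat_diff)
  qed
  finally show ?thesis
    by (simp only: mult.commute[of "of_nat m - 2" \<alpha>] add.assoc)
qed

text \<open>For sign \<open>PlusS\<close> the sum over \<open>noncommuting\<close> cancels term by
  term, so \<open>plus_sum m\<close> acts on the plus vectors as a scalar.\<close>

lemma alg_mult_plus_sum_PlusS: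
  fixes \<alpha> :: "'k::field_char_0"
  assumes "x \<in> transpositions m"
  shows "alg_mult \<alpha> m (plus_sum m) (rho x PlusS) = scale (1 + \<alpha> * (of_nat m - 2)) (rho x PlusS)"
  using assms by (elim transpositionsE) (simp add: alg_mult_plus_sum vec.scale_left_distrib)

lemma alg_mult_plus_sum_MinusS:
  fixes \<alpha> :: "'k::field_char_0"
  assumes "x \<in> transpositions m"
  shows "alg_mult \<alpha> m (plus_sum m) (rho x MinusS) =
    scale (\<alpha> * (of_nat m - 2)) (rho x MinusS) + scale (\<alpha> / 2) (\<Sum>y\<in>noncommuting m x. rho_diff y)"
  using assms by (elim transpositionsE) (simp add: alg_mult_plus_sum rho_diff_def)

text \<open>Since \<open>id_A\<close> is a definite description, both existence and uniqueness are
  needed. The rescaled \<open>plus_sum m\<close> fixes the spanning vectors of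
  \<open>A_sub m\<close>, hence the whole span.\<close>

lemma id_A_eq:
  fixes \<alpha> :: "'k::field_char_0"
  assumes nz: "1 + \<alpha> * (of_nat m - 2) \<noteq> 0"
  shows "id_A \<alpha> m = scale (1 / (1 + \<alpha> * (of_nat m - 2))) (plus_sum m)"
proof -
  let ?u = "scale (1 / (1 + \<alpha> * (of_nat m - 2))) (plus_sum m) :: 'k vec"
  have u: "?u \<in> A_sub m"
    unfolding A_sub_def plus_sum_def
    by (intro vec.span_scale vec.span_sum vec.span_base) blast
  have id_left: "alg_mult \<alpha> m ?u v = v" if "v \<in> A_sub m" for v
    using that unfolding A_sub_def
  proof (induction rule: vec.span_induct_alt)
    case base
    show ?case
      by (rule module_hom.zero[OF module_hom_alg_mult])
  next
    case (step c x y)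
    then obtain t where "x = rho t PlusS" "t \<in> transpositions m"
      by blast
    then have "alg_mult \<alpha> m ?u x = x"
      using nz by (simp add: alg_mult_scale_left alg_mult_plus_sum_PlusS)
    then show ?case
      by (simp only: alg_mult_add_right alg_mult_scale_right step.IH)
  qed
  show ?thesis
    unfolding id_A_def
  proof (rule the_equality)
    show "is_identity \<alpha> m (A_sub m) ?u"
      using u id_left by (simp add: is_identity_def alg_mult_commute[of \<alpha> m _ ?u])
    \<comment> \<open>The product of \<open>?u\<close> and w equals w because \<open>?u\<close> is
      an identity, and equals \<open>?u\<close> because w is one.\<close>
    show "w = ?u" if "is_identity \<alpha> m (A_sub m) w" for w
      using that u id_left unfolding is_identity_def by metis
  qed
qed

section \<open>Star sums and Klein four-groups generated by transpositions\<close>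

definition star_sum :: "nat \<Rightarrow> nat \<Rightarrow> 'k::field vec" where
  "star_sum m i = (\<Sum>k\<in>{1..m} - {i}. rho_diff (transpose i k))"

text \<open>The stars at i and j together cover the noncommuting transpositions once each, and
  additionally contain (i j) itself twice; the last term removes those two copies.\<close>

lemma sum_rho_diff_noncommuting:
  assumes "i \<in> {1..m}" "j \<in> {1..m}" "i \<noteq> j"
  shows "(\<Sum>x\<in>noncommuting m (transpose i j). rho_diff x) =
    star_sum m i + star_sum m j - scale 2 (rho_diff (transpose i j) :: 'k::field vec)"
proof -
  have "star_sum m i = rho_diff (transpose i j)
      + (\<Sum>k\<in>{1..m} - {i, j}. rho_diff (transpose i k) :: 'k vec)"
    unfolding star_sum_def using assms
    by (subst sum.remove[of _ j]) (auto intro!: sum.cong)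
  moreover have "star_sum m j = rho_diff (transpose i j)
      + (\<Sum>k\<in>{1..m} - {i, j}. rho_diff (transpose j k) :: 'k vec)"
    unfolding star_sum_def using assms
    by (subst sum.remove[of _ i]) (auto intro!: sum.cong simp: transpose_commute)
  moreover have "scale 2 v = v + v" for v :: "'k vec"
    by (simp add: scale_def fun_eq_iff)
  ultimately show ?thesis
    by (simp add: sum_noncommuting[OF assms] sum.distrib)
qed

lemma card_klein_four: "card (carrier klein_four) = 4"
  by (simp add: carrier_integer_mod_group)

text \<open>Being abelian of order four forces a and b to commute and to differ, so they are
  disjoint and the support consists of their four points.\<close>

lemma klein_four_transpositions:
  assumes a: "a \<in> transpositions m" and b: "b \<in> transpositions m"
    and iso: "subgroup_generated (sym_group m) {a, b} \<cong> klein_four"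
  obtains i j k l where "a = transpose i j" "b = transpose k l"
    "i \<in> {1..m}" "j \<in> {1..m}" "k \<in> {1..m}" "l \<in> {1..m}" "distinct [i, j, k, l]"
    "perm_support m (carrier (subgroup_generated (sym_group m) {a, b})) = {i, j, k, l}"
proof -
  let ?G = "sym_group m"
  let ?H = "subgroup_generated ?G {a, b}"
  have "{a, b} \<subseteq> carrier ?G"
    using a b by (simp add: sym_group_carrier transpositions_permutes del: One_nat_def)
  then have H: "carrier ?H = generate ?G {a, b}"
    by (simp add: carrier_subgroup_generated Int_absorb1)
  have inH: "a \<in> carrier ?H" "b \<in> carrier ?H"
    unfolding H by (auto intro: generate.incl)
  obtain f where f: "f \<in> iso ?H klein_four"
    using iso by (auto simp: is_iso_def)
  then have bij: "bij_betw f (carrier ?H) (carrier klein_four)"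
    and hom: "f \<in> hom ?H klein_four"
    by (auto simp: iso_def)
  \<comment> \<open>The target group is commutative, and injectivity of f pulls this back.\<close>
  have comm: "a \<circ> b = b \<circ> a"
  proof -
    have mult: "f (x \<circ> y) = f x \<otimes>\<^bsub>klein_four\<^esub> f y" if "x \<in> carrier ?H" "y \<in> carrier ?H" for x y
      using hom_mult[OF hom that] by (simp add: sym_group_mult)
    have "f (a \<circ> b) = f (b \<circ> a)"
      by (simp only: mult inH) (simp add: DirProd_def case_prod_beta add.commute)
    moreover have "a \<circ> b \<in> carrier ?H" "b \<circ> a \<in> carrier ?H"
      using generate.eng[of _ ?G "{a, b}"] inH unfolding H by (auto simp: sym_group_mult)
    ultimately show ?thesis
      using bij by (auto simp: bij_betw_def dest: inj_onD)
  qed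
  have "a \<noteq> b"
  proof
    assume "a = b"
    have bb: "b (b t) = t" for t
      using transpositions_square[OF b] by (simp add: fun_eq_iff)
    \<comment> \<open>A single involution generates at most two elements, fewer than the four
      required.\<close>
    have "carrier ?H \<subseteq> {id, a}"
    proof
      fix h assume "h \<in> carrier ?H"
      then have "h \<in> generate ?G {a, b}"
        by (simp add: H)
      then show "h \<in> {id, a}"
        by induction
           (use b \<open>a = b\<close> in \<open>auto simp: sym_group_mult sym_group_one inv_sym_group_transpositions
              bb fun_eq_iff[of _ id]\<close>)
    qed
    then have "card (carrier ?H) \<le> card {id, a}"
      by (intro card_mono) auto
    also have "\<dots> \<le> 2"
      by (simp add: card_insert_if)
    finally show False
      using bij_betw_same_card[OF bij] by (simp only: card_klein_four)
  qed
  from a obtain i j where ij: "a = transpose i j" "i \<in> {1..m}" "j \<in> {1..m}" "i \<noteq> j"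
    by (rule transpositionsE)
  from b obtain k l where kl: "b = transpose k l" "k \<in> {1..m}" "l \<in> {1..m}" "k \<noteq> l"
    by (rule transpositionsE)
  \<comment> \<open>Commutation excludes one common point of a and b; a \<noteq> b excludes
    two.\<close>
  have "b \<notin> noncommuting m (transpose i j)"
    using comm ij by (simp add: noncommuting_def)
  then have nc: "t \<in> {1..m} - {i, j} \<Longrightarrow> b \<noteq> transpose i t \<and> b \<noteq> transpose j t" for t
    unfolding noncommuting_transpose[OF ij(2-4)] by blast
  have dist: "distinct [i, j, k, l]"
  proof -
    have b': "b = transpose l k"
      using kl(1) by (simp add: transpose_commute)
    have "t \<in> {1..m} - {i, j} \<Longrightarrow> {k, l} \<noteq> {i, t} \<and> {k, l} \<noteq> {j, t}" for t
      using nc[of t] kl(1) b' by (auto simp: doubleton_eq_iff)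
    moreover have "{k, l} \<noteq> {i, j}"
      using \<open>a \<noteq> b\<close> ij(1) kl(1) b' by (auto simp: doubleton_eq_iff)
    ultimately have "k \<notin> {i, j} \<and> l \<notin> {i, j}"
      using kl(2-4) by blast
    then show ?thesis
      using ij(4) kl(4) by auto
  qed
  have "perm_support m (carrier ?H) = {i, j, k, l}"
  proof (intro equalityI subsetI)
    fix t assume "t \<in> perm_support m (carrier ?H)"
    then obtain h where h: "h \<in> generate ?G {a, b}" "h t \<noteq> t"
      by (auto simp: perm_support_def H)
    show "t \<in> {i, j, k, l}"
    proof (rule ccontr)
      assume t: "t \<notin> {i, j, k, l}"
      have "h t = t"
        using h(1)
        by induction
           (use a b t in \<open>auto simp: sym_group_mult sym_group_one inv_sym_group_transpositions
              ij(1) kl(1)\<close>)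
      with h(2) show False ..
    qed
  next
    fix t assume t: "t \<in> {i, j, k, l}"
    then have "a t \<noteq> t \<or> b t \<noteq> t"
      using dist by (auto simp: ij(1) kl(1))
    then show "t \<in> perm_support m (carrier ?H)"
      using t inH ij kl by (auto simp: perm_support_def)
  qed
  with ij kl dist show thesis
    by (intro that)
qed

text \<open>The four stars at the points of a and b add up to a sum over the support alone, which
  will cancel between the two pairs. Distinctness of a and b is recorded for the nonvanishing
  argument.\<close>

lemma sum_rho_diff_klein_four:
  assumes "a \<in> transpositions m" "b \<in> transpositions m"
    and "subgroup_generated (sym_group m) {a, b} \<cong> klein_four"
  shows "(\<Sum>x\<in>noncommuting m a. rho_diff x) + (\<Sum>x\<in>noncommuting m b. rho_diff x) =
    (\<Sum>i\<in>perm_support m (carrier (subgroup_generated (sym_group m) {a, b})). star_sum m i)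
    - scale 2 (rho_diff a + rho_diff b :: 'k::field vec)"
    and "a \<noteq> b"
proof -
  from assms obtain i j k l where *: "a = transpose i j" "b = transpose k l"
    "i \<in> {1..m}" "j \<in> {1..m}" "k \<in> {1..m}" "l \<in> {1..m}" "distinct [i, j, k, l]"
    "perm_support m (carrier (subgroup_generated (sym_group m) {a, b})) = {i, j, k, l}"
    by (rule klein_four_transpositions)
  then have ne: "i \<noteq> j" "k \<noteq> l"
    by auto
  then show "(\<Sum>x\<in>noncommuting m a. rho_diff x) + (\<Sum>x\<in>noncommuting m b. rho_diff x) =
    (\<Sum>i\<in>perm_support m (carrier (subgroup_generated (sym_group m) {a, b})). star_sum m i)
    - scale 2 (rho_diff a + rho_diff b :: 'k vec)"
    using *(7) unfolding *(8) unfolding *(1,2)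
    by (simp add: sum_rho_diff_noncommuting[OF *(3,4) ne(1)]
        sum_rho_diff_noncommuting[OF *(5,6) ne(2)] vec.scale_right_distrib)
  have "a i = j" "b i = i"
    using *(7) by (auto simp: *(1,2))
  then show "a \<noteq> b"
    using ne(1) by auto
qed

section \<open>The eigenvector\<close>

theorem lemma3p18:
  fixes \<alpha> :: "'k::field_char_0"
    and m :: nat
    and a b c d :: "nat \<Rightarrow> nat"
  assumes "\<alpha> \<noteq> 0" and "\<alpha> \<noteq> 1"
    and "1 + \<alpha> * (of_nat m - 2) \<noteq> 0"
    and "a \<in> transpositions m" and "b \<in> transpositions m"
    and "c \<in> transpositions m" and "d \<in> transpositions m"
    and "subgroup_generated (sym_group m) {a, b} \<cong> klein_four"
    and "subgroup_generated (sym_group m) {c, d} \<cong> klein_four"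
    and "perm_support m (carrier (subgroup_generated (sym_group m) {a, b})) =
         perm_support m (carrier (subgroup_generated (sym_group m) {c, d}))"
    and "{a, b} \<noteq> {c, d}"
  shows "is_eigenvector \<alpha> m (id_A \<alpha> m) (eta_hat \<alpha> m)
           (scale \<alpha> (rho a PlusS + rho b PlusS - rho c PlusS - rho d PlusS) +
            scale (1 - \<alpha>) (rho a MinusS + rho b MinusS - rho c MinusS - rho d MinusS))"
proof -
  let ?P = "rho a PlusS + rho b PlusS - rho c PlusS - rho d PlusS :: 'k vec"
  let ?M = "rho a MinusS + rho b MinusS - rho c MinusS - rho d MinusS :: 'k vec"
  let ?v = "scale \<alpha> ?P + scale (1 - \<alpha>) ?M"
  let ?n = "1 + \<alpha> * (of_nat m - 2)"
  let ?N = "\<lambda>x. \<Sum>y\<in>noncommuting m x. rho_diff y :: 'k vec"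
  note T = assms(4-7)
  note ab = sum_rho_diff_klein_four[OF assms(4,5,8)]
    and cd = sum_rho_diff_klein_four[OF assms(6,7,9)]
  have "?v \<in> A_hat m"
    unfolding A_hat_def using T
    by (intro vec.span_add vec.span_scale vec.span_diff vec.span_base) blast+
  moreover have "?v \<noteq> 0"
  proof
    assume "?v = 0"
    then have v0: "?v p = 0" for p
      by simp
    \<comment> \<open>Two distinct elements inside \<open>{c, d}\<close> would exhaust it. At an
      element outside \<open>{c, d}\<close> nothing cancels, so its minus coefficient is 1 -
      \<alpha>, which is nonzero.\<close>
    have "a \<notin> {c, d} \<or> b \<notin> {c, d}"
      using assms(11) ab(2) by auto
    then have "?v (a, MinusS) = 1 - \<alpha> \<or> ?v (b, MinusS) = 1 - \<alpha>"
      using ab(2) by (auto simp: rho_def scale_def)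
    then show False
      using v0 assms(2) by auto
  qed
  moreover have "alg_mult \<alpha> m (id_A \<alpha> m) ?v = scale (eta_hat \<alpha> m) ?v"
  proof -
    have P: "alg_mult \<alpha> m (plus_sum m) ?P = scale ?n ?P"
      using T by (simp add: alg_mult_add_right alg_mult_diff_right alg_mult_plus_sum_PlusS
          vec.scale_right_distrib vec.scale_right_diff_distrib)
    \<comment> \<open>Equal supports make the star sums of the two pairs cancel.\<close>
    have "?N a + ?N b - (?N c + ?N d) = scale (- 2) (?P - ?M)"
      unfolding ab(1) cd(1) assms(10)
      by (simp add: rho_diff_def scale_def fun_eq_iff algebra_simps)
    then have "scale (\<alpha> / 2) (?N a + ?N b - (?N c + ?N d)) = scale \<alpha> (?M - ?P)"
      by (simp only:) (simp add: scale_def fun_eq_iff algebra_simps)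
    moreover have "alg_mult \<alpha> m (plus_sum m) ?M =
        scale (\<alpha> * (of_nat m - 2)) ?M + scale (\<alpha> / 2) (?N a + ?N b - (?N c + ?N d))"
      using T by (simp add: alg_mult_add_right alg_mult_diff_right alg_mult_plus_sum_MinusS
          vec.scale_right_distrib vec.scale_right_diff_distrib)
    ultimately have M: "alg_mult \<alpha> m (plus_sum m) ?M =
        scale (\<alpha> * (of_nat m - 2)) ?M + scale \<alpha> (?M - ?P)"
      by simp
    \<comment> \<open>The weights \<alpha> and 1 - \<alpha> are what makes this work: the
      coefficient of \<open>?P\<close> becomes \<alpha> \<open>?n\<close> - \<alpha> (1 - \<alpha>),
      which is \<alpha> times \<alpha> (m - 1), and that of \<open>?M\<close> becomes 1 - \<alpha>
      times \<alpha> (m - 1).\<close>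
    have "alg_mult \<alpha> m (plus_sum m) ?v = scale (\<alpha> * (of_nat m - 1)) ?v"
      unfolding alg_mult_add_right[of _ _ _ "scale \<alpha> ?P"] alg_mult_scale_right P M
      by (simp add: scale_def fun_eq_iff algebra_simps)
    then show ?thesis
      by (simp add: id_A_eq[OF assms(3)] alg_mult_scale_left eta_hat_def)
  qed
  ultimately show ?thesis
    by (simp add: is_eigenvector_def)
qed

end
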